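(* Let $L$ be a frame. A congruence $C$ on $L$ is rare if and only if whenever $a,b\in L$ and $a<b$, there exists a pair $(c,d)\in C$ with $a\le c<d\le b$.
   Context: A congruence on a frame $L$ is an equivalence relation on $L$ that is a subframe of $L\times L$ (closed under finite meets and arbitrary joins). The congruences on $L$, ordered by inclusion, form a frame $\mathbb{C}L$. A congruence $C$ is called rare if it is a dense element of the frame $\mathbb{C}L$, i.e. its pseudocomplement in $\mathbb{C}L$ is $0$ (equivalently $C\wedge D\neq 0$ for every nonzero $D\in\mathbb{C}L$, where $0$ is the equality relation). *)

theory Defs
  imports Main "HOL-Library.Product_Order"
begin

class frame = complete_lattice +
  assumes inf_Sup_frame: "inf a (Sup B) = (SUP b\<in>B. inf a b)"

lemma inf_sup_distrib_frame:
  fixes a b c :: "'a::frame"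
  shows "inf a (sup b c) = sup (inf a b) (inf a c)"
  using inf_Sup_frame[of a "{b, c}"] by simp

lemma sup_inf_distrib_frame:
  fixes a b c :: "'a::frame"
  shows "sup (inf b c) a = inf (sup b a) (sup c a)"
proof -
  have "sup a (inf b c) = inf (sup a b) (sup a c)"
    by (rule distrib_imp1) (rule inf_sup_distrib_frame)
  then show ?thesis by (simp add: sup_commute)
qed

instance prod :: (frame, frame) frame
proof
  fix a :: "'a \<times> 'b" and B :: "('a \<times> 'b) set"
  show "inf a (Sup B) = (SUP b\<in>B. inf a b)"
    by (simp add: Sup_prod_def inf_prod_def inf_Sup_frame image_comp o_def)
qed

definition subframe :: "'a::frame set \<Rightarrow> bool" where
  "subframe S \<longleftrightarrow>
     (\<forall>A. finite A \<and> A \<subseteq> S \<longrightarrow> Inf A \<in> S) \<and> (\<forall>A. A \<subseteq> S \<longrightarrow> Sup A \<in> S)"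

text \<open>The frame structure on pairs is the componentwise one, from \<^theory>\<open>HOL-Library.Product_Order\<close>.\<close>

definition frame_congruence :: "('a::frame \<times> 'a) set \<Rightarrow> bool" where
  "frame_congruence C \<longleftrightarrow> equiv UNIV C \<and> subframe C"

lemma frame_congruence_Inter:
  assumes "\<And>C. C \<in> X \<Longrightarrow> frame_congruence C"
  shows "frame_congruence (\<Inter>X)"
proof -
  have "equiv UNIV (\<Inter>X)"
  proof (rule equivI)
    show "refl (\<Inter>X)" "sym (\<Inter>X)"
      using assms by (auto simp: frame_congruence_def equiv_def intro!: refl_onI symI
          dest: refl_onD symD)
    show "trans (\<Inter>X)"
      using assms unfolding frame_congruence_def equiv_def by (blast intro: transI dest: transD)
  qed simp
  moreover have "subframe (\<Inter>X)"
    using assms unfolding frame_congruence_def subframe_def by (auto simp: le_Inf_iff)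
  ultimately show ?thesis by (simp add: frame_congruence_def)
qed

typedef (overloaded) ('a::frame) congruence = "{C :: ('a \<times> 'a) set. frame_congruence C}"
  morphisms rel_of Congruence
proof
  show "UNIV \<in> {C :: ('a \<times> 'a) set. frame_congruence C}"
    by (simp add: frame_congruence_def subframe_def equiv_def refl_on_def sym_def trans_def)
qed

setup_lifting type_definition_congruence

instantiation congruence :: (frame) complete_lattice
begin

lift_definition less_eq_congruence :: "'a congruence \<Rightarrow> 'a congruence \<Rightarrow> bool" is "(\<subseteq>)" .

lift_definition less_congruence :: "'a congruence \<Rightarrow> 'a congruence \<Rightarrow> bool" is "(\<subset>)" .

lift_definition Inf_congruence :: "'a congruence set \<Rightarrow> 'a congruence" is "Inter"
  by (rule frame_congruence_Inter)

lift_definition inf_congruence :: "'a congruence \<Rightarrow> 'a congruence \<Rightarrow> 'a congruence" is "(\<inter>)"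
  using frame_congruence_Inter[of "{_, _}"] by auto

definition Sup_congruence :: "'a congruence set \<Rightarrow> 'a congruence" where
  "Sup X = (Inf {D. \<forall>C\<in>X. C \<le> D} :: 'a congruence)"

definition sup_congruence :: "'a congruence \<Rightarrow> 'a congruence \<Rightarrow> 'a congruence" where
  "sup C D = (Sup {C, D} :: 'a congruence)"

definition bot_congruence :: "'a congruence" where
  "bot = (Sup {} :: 'a congruence)"

definition top_congruence :: "'a congruence" where
  "top = (Inf {} :: 'a congruence)"

instance
proof
  have lower: "Inf X \<le> C" if "C \<in> X" for C :: "'a congruence" and X
    using that by transfer auto
  have greatest: "D \<le> Inf X" if "\<And>C. C \<in> X \<Longrightarrow> D \<le> C" for D :: "'a congruence" and X
    using that by transfer auto
  fix C D E :: "'a congruence" and X :: "'a congruence set"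
  show "(C < D) = (C \<le> D \<and> \<not> D \<le> C)" by transfer auto
  show "C \<le> C" by transfer auto
  show "C \<le> D \<Longrightarrow> D \<le> E \<Longrightarrow> C \<le> E" by transfer auto
  show "C \<le> D \<Longrightarrow> D \<le> C \<Longrightarrow> C = D" by transfer auto
  show "inf C D \<le> C" "inf C D \<le> D" by (transfer; auto)+
  show "C \<le> D \<Longrightarrow> C \<le> E \<Longrightarrow> C \<le> inf D E" by transfer auto
  show "C \<in> X \<Longrightarrow> Inf X \<le> C" by (rule lower)
  show "(\<And>C. C \<in> X \<Longrightarrow> D \<le> C) \<Longrightarrow> D \<le> Inf X" by (rule greatest)
  show "C \<in> X \<Longrightarrow> C \<le> Sup X" unfolding Sup_congruence_def by (rule greatest) auto
  show "(\<And>C. C \<in> X \<Longrightarrow> C \<le> D) \<Longrightarrow> Sup X \<le> D" unfolding Sup_congruence_def by (rule lower) auto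
  show "C \<le> sup C D" "D \<le> sup C D"
    unfolding sup_congruence_def Sup_congruence_def by (rule greatest; auto)+
  show "C \<le> D \<Longrightarrow> E \<le> D \<Longrightarrow> sup C E \<le> D"
    unfolding sup_congruence_def Sup_congruence_def by (rule lower) auto
  show "Inf {} = (top :: 'a congruence)" by (simp add: top_congruence_def)
  show "Sup {} = (bot :: 'a congruence)" by (simp add: bot_congruence_def)
qed

end

lemma frame_congruence_Id: "frame_congruence (Id :: ('a::frame \<times> 'a) set)"
proof -
  have *: "fst ` A = snd ` A" if "A \<subseteq> Id" for A :: "('a \<times> 'a) set"
    using that by (force simp: image_iff)
  have "equiv UNIV (Id :: ('a \<times> 'a) set)"
    by (simp add: equiv_def refl_Id sym_Id trans_Id)
  then show ?thesis
    by (simp add: frame_congruence_def subframe_def Inf_prod_def Sup_prod_def *)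
qed

lemma rel_of_bot: "rel_of (bot :: 'a::frame congruence) = Id"
proof
  have "bot \<le> Congruence (Id :: ('a \<times> 'a) set)" by simp
  then show "rel_of (bot :: 'a congruence) \<subseteq> Id"
    by (simp add: less_eq_congruence.rep_eq Congruence_inverse frame_congruence_Id)
  show "Id \<subseteq> rel_of (bot :: 'a congruence)"
    using rel_of[of "bot :: 'a congruence"]
    by (auto simp: frame_congruence_def equiv_def refl_on_def)
qed

text \<open>
  For distributivity in the lattice of congruences, \<open>relimp C E\<close> is a congruence above
  every \<open>D\<close> with \<open>C \<inter> D \<subseteq> E\<close>, and its meet with \<open>C\<close> lies below \<open>E\<close>.
\<close>

definition clamp :: "'a::frame \<Rightarrow> 'a \<Rightarrow> 'a \<Rightarrow> 'a" where
  "clamp x y a = sup (inf x a) y"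

definition relimp :: "('a::frame \<times> 'a) set \<Rightarrow> ('a \<times> 'a) set \<Rightarrow> ('a \<times> 'a) set" where
  "relimp C E = {(a, b). \<forall>x y. (x, y) \<in> C \<and> y \<le> x \<longrightarrow> (clamp x y a, clamp x y b) \<in> E}"

lemma congruence_refl: "frame_congruence C \<Longrightarrow> (a, a) \<in> C"
  by (auto simp: frame_congruence_def equiv_def refl_on_def)

lemma congruence_sym: "frame_congruence C \<Longrightarrow> (a, b) \<in> C \<Longrightarrow> (b, a) \<in> C"
  by (auto simp: frame_congruence_def equiv_def dest: symD)

lemma congruence_trans: "frame_congruence C \<Longrightarrow> (a, b) \<in> C \<Longrightarrow> (b, c) \<in> C \<Longrightarrow> (a, c) \<in> C"
  by (auto simp: frame_congruence_def equiv_def dest: transD)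

lemma congruence_Inf:
  "frame_congruence C \<Longrightarrow> finite A \<Longrightarrow> A \<subseteq> C \<Longrightarrow> (Inf (fst ` A), Inf (snd ` A)) \<in> C"
  by (metis frame_congruence_def subframe_def Inf_prod_def)

lemma congruence_Sup:
  "frame_congruence C \<Longrightarrow> A \<subseteq> C \<Longrightarrow> (Sup (fst ` A), Sup (snd ` A)) \<in> C"
  by (metis frame_congruence_def subframe_def Sup_prod_def)

lemma congruence_inf:
  "frame_congruence C \<Longrightarrow> (a, b) \<in> C \<Longrightarrow> (c, d) \<in> C \<Longrightarrow> (inf a c, inf b d) \<in> C"
  using congruence_Inf[of C "{(a, b), (c, d)}"] by simp

lemma congruence_sup:
  "frame_congruence C \<Longrightarrow> (a, b) \<in> C \<Longrightarrow> (c, d) \<in> C \<Longrightarrow> (sup a c, sup b d) \<in> C"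
  using congruence_Sup[of C "{(a, b), (c, d)}"] by simp

lemma clamp_inf: "clamp x y (inf a b) = inf (clamp x y a) (clamp x y b)"
proof -
  have "inf x (inf a b) = inf (inf x a) (inf x b)"
    by (simp add: inf_assoc inf_left_commute)
  then show ?thesis by (simp add: clamp_def sup_inf_distrib_frame)
qed

lemma clamp_Sup: "clamp x y (Sup A) = sup y (Sup (clamp x y ` A))"
proof (rule antisym)
  show "clamp x y (Sup A) \<le> sup y (Sup (clamp x y ` A))"
    unfolding clamp_def inf_Sup_frame
  proof (intro sup_least SUP_least)
    fix a assume "a \<in> A"
    then have "sup (inf x a) y \<le> (SUP a\<in>A. sup (inf x a) y)" by (rule SUP_upper)
    then have "inf x a \<le> (SUP a\<in>A. sup (inf x a) y)" by simp
    then show "inf x a \<le> sup y (SUP a\<in>A. sup (inf x a) y)" by (rule le_supI2)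
  qed simp
  show "sup y (Sup (clamp x y ` A)) \<le> clamp x y (Sup A)"
    unfolding clamp_def
    by (intro sup_least SUP_least sup_mono inf_mono order_refl sup_ge2 Sup_upper)
qed

lemma clamp_in_congruence:
  assumes "frame_congruence C" "(x, y) \<in> C" "y \<le> x"
  shows "(clamp x y a, clamp x y b) \<in> C"
proof -
  have *: "(clamp x y a, y) \<in> C" for a
    using congruence_sup[OF assms(1) congruence_inf[OF assms(1,2) congruence_refl[OF assms(1), of a]]
        congruence_refl[OF assms(1), of y]]
    by (simp add: clamp_def sup_absorb2)
  show ?thesis
    using congruence_trans[OF assms(1) * congruence_sym[OF assms(1) *]] .
qed

lemma frame_congruence_relimp:
  assumes E: "frame_congruence E"
  shows "frame_congruence (relimp C E)"
proof -
  have "equiv UNIV (relimp C E)"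
  proof (rule equivI)
    show "refl (relimp C E)"
      by (auto simp: relimp_def refl_on_def congruence_refl[OF E])
    show "sym (relimp C E)"
      by (auto simp: relimp_def sym_def intro: congruence_sym[OF E])
    show "trans (relimp C E)"
      unfolding relimp_def trans_def using congruence_trans[OF E] by blast
  qed simp
  moreover have "Inf A \<in> relimp C E" if "finite A" "A \<subseteq> relimp C E" for A
    using that
  proof (induction A)
    case empty
    show ?case by (simp add: relimp_def congruence_refl[OF E] top_prod_def)
  next
    case (insert p A)
    obtain a b where p: "p = (a, b)" by (cases p)
    obtain c d where A: "Inf A = (c, d)" by (cases "Inf A")
    have "(a, b) \<in> relimp C E" "(c, d) \<in> relimp C E"
      using insert p A by auto
    then have "(inf a c, inf b d) \<in> relimp C E"
      by (auto simp: relimp_def clamp_inf intro: congruence_inf[OF E])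
    then show ?case by (simp add: p A)
  qed
  moreover have "Sup A \<in> relimp C E" if A: "A \<subseteq> relimp C E" for A
  proof -
    have "(clamp x y (Sup (fst ` A)), clamp x y (Sup (snd ` A))) \<in> E"
      if "(x, y) \<in> C" "y \<le> x" for x y
    proof -
      let ?B = "(\<lambda>p. (clamp x y (fst p), clamp x y (snd p))) ` A"
      have "?B \<subseteq> E"
        using A that by (force simp: relimp_def)
      from congruence_Sup[OF E this]
      have "(Sup (clamp x y ` fst ` A), Sup (clamp x y ` snd ` A)) \<in> E"
        by (simp add: image_image)
      from congruence_sup[OF E congruence_refl[OF E, of y] this]
      show ?thesis by (simp add: clamp_Sup)
    qed
    then show ?thesis by (auto simp: relimp_def Sup_prod_def)
  qed
  ultimately show ?thesis
    by (auto simp: frame_congruence_def subframe_def)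
qed

lemma relimp_upper:
  assumes "frame_congruence C" "frame_congruence D" "C \<inter> D \<subseteq> E"
  shows "D \<subseteq> relimp C E"
proof
  fix p assume "p \<in> D"
  moreover obtain a b where p: "p = (a, b)" by (cases p)
  ultimately have ab: "(a, b) \<in> D" by simp
  have "(clamp x y a, clamp x y b) \<in> E" if "(x, y) \<in> C" "y \<le> x" for x y
  proof -
    have "(clamp x y a, clamp x y b) \<in> D"
      unfolding clamp_def
      by (intro congruence_sup[OF assms(2)] congruence_inf[OF assms(2)] congruence_refl[OF assms(2)] ab)
    then show ?thesis
      using clamp_in_congruence[OF assms(1) that] assms(3) by blast
  qed
  then show "p \<in> relimp C E" by (simp add: relimp_def p)
qed

lemma relimp_meet:
  assumes "frame_congruence C"
  shows "C \<inter> relimp C E \<subseteq> E"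
proof
  fix p assume "p \<in> C \<inter> relimp C E"
  moreover obtain a b where p: "p = (a, b)" by (cases p)
  ultimately have ab: "(a, b) \<in> C" "(a, b) \<in> relimp C E" by auto
  have "(sup a b, sup b b) \<in> C" "(inf a b, inf b b) \<in> C"
    using congruence_sup[OF assms ab(1) congruence_refl[OF assms, of b]]
      congruence_inf[OF assms ab(1) congruence_refl[OF assms, of b]] by auto
  then have "(sup a b, b) \<in> C" "(inf a b, b) \<in> C" by simp_all
  then have "(sup a b, inf a b) \<in> C"
    using congruence_trans[OF assms] congruence_sym[OF assms] by blast
  moreover have "inf a b \<le> sup a b" by (simp add: le_infI1)
  ultimately have "(clamp (sup a b) (inf a b) a, clamp (sup a b) (inf a b) b) \<in> E"
    using ab(2) by (auto simp: relimp_def)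
  moreover have "clamp (sup a b) (inf a b) a = a" "clamp (sup a b) (inf a b) b = b"
    by (simp_all add: clamp_def inf_absorb2 sup_absorb1)
  ultimately show "p \<in> E" by (simp add: p)
qed

instance congruence :: (frame) frame
proof
  fix C :: "'a congruence" and X :: "'a congruence set"
  let ?E = "SUP D\<in>X. inf C D"
  let ?F = "Congruence (relimp (rel_of C) (rel_of ?E))"
  have cong: "frame_congruence (rel_of D)" for D :: "'a congruence"
    using rel_of[of D] by simp
  have F: "rel_of ?F = relimp (rel_of C) (rel_of ?E)"
    by (simp add: Congruence_inverse frame_congruence_relimp cong)
  have "D \<le> ?F" if "D \<in> X" for D
  proof -
    have "inf C D \<le> ?E" using that by (rule SUP_upper)
    then have "rel_of C \<inter> rel_of D \<subseteq> rel_of ?E"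
      by (simp add: less_eq_congruence.rep_eq inf_congruence.rep_eq)
    then show ?thesis
      unfolding less_eq_congruence.rep_eq F by (rule relimp_upper[OF cong cong])
  qed
  then have "Sup X \<le> ?F" by (rule Sup_least)
  then have "inf C (Sup X) \<le> inf C ?F" by (rule inf_mono[OF order_refl])
  also have "inf C ?F \<le> ?E"
    unfolding less_eq_congruence.rep_eq inf_congruence.rep_eq F by (rule relimp_meet[OF cong])
  finally have "inf C (Sup X) \<le> ?E" .
  moreover have "?E \<le> inf C (Sup X)"
    by (auto intro!: SUP_least intro: le_infI2 Sup_upper)
  ultimately show "inf C (Sup X) = ?E" by (rule antisym)
qed

definition pseudocomplement :: "'a::frame \<Rightarrow> 'a" where
  "pseudocomplement x = Sup {y. inf x y = bot}"

lemma inf_pseudocomplement: "inf x (pseudocomplement x) = bot"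
proof -
  have "inf x (pseudocomplement x) \<le> bot"
    unfolding pseudocomplement_def inf_Sup_frame by (rule SUP_least) simp
  then show ?thesis by (simp add: bot_unique)
qed

definition dense_element :: "'a::frame \<Rightarrow> bool" where
  "dense_element x \<longleftrightarrow> pseudocomplement x = bot"

definition rare :: "'a::frame congruence \<Rightarrow> bool" where
  "rare C \<longleftrightarrow> dense_element C"

end

theory Submission
  imports Defs
begin

text \<open>
  Density of \<open>C\<close> says that \<open>C\<close> meets every nonzero congruence \<open>D\<close> outside the diagonal. If
  \<open>(a, b) \<in> D\<close> with \<open>a \<le> b\<close>, then \<open>D\<close> identifies the whole interval from \<open>a\<close> to \<open>b\<close>; hence a strict
  pair of \<open>C\<close> inside each nontrivial interval meets every nonzero \<open>D\<close>.

  Conversely, given \<open>a < b\<close>, let \<open>D\<close> be the principal congruence generated by \<open>(a, b)\<close>. It consists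
  of the pairs \<open>(x, y)\<close> with \<open>x \<squnion> b = y \<squnion> b\<close> and \<open>x \<sqinter> a = y \<sqinter> a\<close>
  (\<open>mem_interval_congruence\<close>), and it is nonzero, so it shares with a dense \<open>C\<close> a pair \<open>x \<noteq> y\<close>.
  Clamping to the interval sends \<open>x\<close> and \<open>y\<close> to a pair that is still in \<open>C\<close>. Elements agreeing above
  \<open>b\<close>, below \<open>a\<close> and after clamping are equal by distributivity (\<open>clamp_cancel\<close>), so the clamped
  pair is still distinct. Its meet and join form the required strict pair.
\<close>

lemma rare_iff: "rare C \<longleftrightarrow> (\<forall>D. inf C D = bot \<longrightarrow> D = bot)"
proof
  assume C: "rare C"
  show "\<forall>D. inf C D = bot \<longrightarrow> D = bot"
  proof (intro allI impI)
    fix D assume "inf C D = bot"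
    then have "D \<le> pseudocomplement C"
      unfolding pseudocomplement_def by (auto intro: Sup_upper)
    with C show "D = bot" by (simp add: rare_def dense_element_def bot_unique)
  qed
next
  assume "\<forall>D. inf C D = bot \<longrightarrow> D = bot"
  then show "rare C"
    by (simp add: rare_def dense_element_def inf_pseudocomplement)
qed

lemma frame_congruence_rel_of: "frame_congruence (rel_of C)"
  using rel_of[of C] by simp

lemma congruence_eq_bot_iff: "D = bot \<longleftrightarrow> rel_of D \<subseteq> Id"
  by (simp add: rel_of_bot[symmetric] less_eq_congruence.rep_eq[symmetric] bot_unique)

lemma congruence_inf_sup:
  assumes C: "frame_congruence C" and ab: "(a, b) \<in> C"
  shows "(inf a b, sup a b) \<in> C"
proof -
  have "(inf a b, b) \<in> C"
    using congruence_inf[OF C ab congruence_refl[OF C, of b]] by simp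
  moreover have "(sup a b, b) \<in> C"
    using congruence_sup[OF C ab congruence_refl[OF C, of b]] by simp
  ultimately show ?thesis
    by (blast intro: congruence_trans[OF C] congruence_sym[OF C])
qed

lemma inf_less_sup:
  fixes a b :: "'a::lattice"
  assumes "a \<noteq> b"
  shows "inf a b < sup a b"
proof (rule le_neq_trans)
  show "inf a b \<le> sup a b" by (simp add: le_infI1)
  show "inf a b \<noteq> sup a b" using assms by (metis antisym inf_le1 inf_le2 sup_ge1 sup_ge2)
qed

lemma congruence_convex:
  assumes D: "frame_congruence D" and ab: "(a, b) \<in> D" and "a \<le> c" "c \<le> d" "d \<le> b"
  shows "(c, d) \<in> D"
proof -
  have *: "(a, e) \<in> D" if "a \<le> e" "e \<le> b" for e
    using congruence_inf[OF D ab congruence_refl[OF D, of e]] that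
    by (simp add: inf_absorb1 inf_absorb2)
  have "(a, c) \<in> D" "(a, d) \<in> D"
    using assms(3-) by (auto intro!: * elim: order_trans)
  then show ?thesis
    by (blast intro: congruence_trans[OF D] congruence_sym[OF D])
qed

lemma frame_cancel:
  fixes x y a :: "'a::frame"
  assumes "inf x a = inf y a" "sup x a = sup y a"
  shows "x = y"
proof -
  have "x = inf x (sup y a)" by (simp add: assms(2)[symmetric])
  also have "\<dots> = sup (inf x y) (inf x a)" by (rule inf_sup_distrib_frame)
  also have "\<dots> = sup (inf y x) (inf y a)" by (simp add: assms(1) inf_commute[of x y])
  also have "\<dots> = inf y (sup x a)" by (simp add: inf_sup_distrib_frame)
  also have "\<dots> = y" by (simp add: assms(2))
  finally show ?thesis .
qed

text \<open>
  Cancellation at \<open>a\<close> recovers \<open>x \<sqinter> b\<close> from the clamped value and \<open>x \<sqinter> a\<close>; cancellation at \<open>b\<close>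
  then recovers \<open>x\<close> itself.
\<close>

lemma clamp_cancel:
  fixes x y a b :: "'a::frame"
  assumes "a \<le> b" and sup: "sup x b = sup y b" and inf: "inf x a = inf y a"
    and clamp: "clamp b a x = clamp b a y"
  shows "x = y"
proof -
  have "inf (inf z b) a = inf z a" for z
    using \<open>a \<le> b\<close> by (simp add: inf_assoc inf_absorb2)
  then have "inf (inf x b) a = inf (inf y b) a" by (simp add: inf)
  moreover have "sup (inf x b) a = sup (inf y b) a"
    using clamp by (simp add: clamp_def inf_commute)
  ultimately have "inf x b = inf y b" by (rule frame_cancel)
  then show ?thesis using sup by (rule frame_cancel)
qed

text \<open>
  Clamping to the interval from \<open>b\<close> to \<open>\<top>\<close> is \<open>x \<mapsto> x \<squnion> b\<close>, and clamping to the one from \<open>\<bottom>\<close> to \<open>a\<close>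
  is \<open>x \<mapsto> x \<sqinter> a\<close>. The common kernel of these two maps is therefore an instance of \<open>relimp\<close>,
  which is always a congruence when its second argument is.
\<close>

definition interval_congruence :: "'a::frame \<Rightarrow> 'a \<Rightarrow> 'a congruence" where
  "interval_congruence a b = Congruence (relimp {(top, b), (a, bot)} Id)"

lemma mem_interval_congruence:
  "(x, y) \<in> rel_of (interval_congruence a b) \<longleftrightarrow> sup x b = sup y b \<and> inf x a = inf y a"
proof -
  have "rel_of (interval_congruence a b) = relimp {(top, b), (a, bot)} Id"
    unfolding interval_congruence_def
    by (simp add: Congruence_inverse frame_congruence_relimp frame_congruence_Id)
  then show ?thesis
    by (simp add: relimp_def clamp_def imp_conjL imp_disjL all_conj_distrib inf_commute)
qed

theorem mainTheorem7:
  fixes C :: "'a::frame congruence"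
  shows "rare C \<longleftrightarrow>
    (\<forall>a b :: 'a. a < b \<longrightarrow> (\<exists>c d. (c, d) \<in> rel_of C \<and> a \<le> c \<and> c < d \<and> d \<le> b))"
proof
  assume C: "rare C"
  show "\<forall>a b :: 'a. a < b \<longrightarrow> (\<exists>c d. (c, d) \<in> rel_of C \<and> a \<le> c \<and> c < d \<and> d \<le> b)"
  proof (intro allI impI)
    fix a b :: 'a assume "a < b"
    then have "a \<le> b" by simp
    let ?D = "interval_congruence a b"
    have "(a, b) \<in> rel_of ?D"
      using \<open>a \<le> b\<close> by (simp add: mem_interval_congruence sup_absorb2 inf_absorb2)
    then have "?D \<noteq> bot"
      using \<open>a < b\<close> by (auto simp: rel_of_bot)
    with C have "inf C ?D \<noteq> bot" by (auto simp: rare_iff)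
    then obtain x y where xy: "(x, y) \<in> rel_of C" "(x, y) \<in> rel_of ?D" "x \<noteq> y"
      by (auto simp: congruence_eq_bot_iff inf_congruence.rep_eq)
    define c where "c = clamp b a x"
    define d where "d = clamp b a y"
    have "c \<noteq> d"
      using xy(2,3) clamp_cancel[OF \<open>a \<le> b\<close>] by (auto simp: c_def d_def mem_interval_congruence)
    have "(c, d) \<in> rel_of C"
      unfolding c_def d_def clamp_def
      by (intro congruence_sup congruence_inf congruence_refl frame_congruence_rel_of xy(1))
    then have "(inf c d, sup c d) \<in> rel_of C"
      by (rule congruence_inf_sup[OF frame_congruence_rel_of])
    moreover have "a \<le> inf c d" "sup c d \<le> b"
      using \<open>a \<le> b\<close> by (simp_all add: c_def d_def clamp_def)
    ultimately show "\<exists>c d. (c, d) \<in> rel_of C \<and> a \<le> c \<and> c < d \<and> d \<le> b"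
      using inf_less_sup[OF \<open>c \<noteq> d\<close>] by blast
  qed
next
  assume strict: "\<forall>a b :: 'a. a < b \<longrightarrow> (\<exists>c d. (c, d) \<in> rel_of C \<and> a \<le> c \<and> c < d \<and> d \<le> b)"
  have "inf C D \<noteq> bot" if "D \<noteq> bot" for D
  proof -
    obtain a b where "(a, b) \<in> rel_of D" "a \<noteq> b"
      using \<open>D \<noteq> bot\<close> by (auto simp: congruence_eq_bot_iff)
    then have D: "(inf a b, sup a b) \<in> rel_of D" and "inf a b < sup a b"
      by (auto intro: congruence_inf_sup frame_congruence_rel_of inf_less_sup)
    with strict obtain c d where cd: "(c, d) \<in> rel_of C" "inf a b \<le> c" "c < d" "d \<le> sup a b"
      by blast
    have "(c, d) \<in> rel_of D"
      using congruence_convex[OF frame_congruence_rel_of D] cd(2-) by simp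
    with cd(1,3) show ?thesis
      by (auto simp: congruence_eq_bot_iff inf_congruence.rep_eq)
  qed
  then show "rare C" by (auto simp: rare_iff)
qed

end
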